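(* Let $a^0\in\mathbb{R}^m_{++}$, $\tau\ge 0$, and let $A\in\mathbb{R}^{m\times m}$ be non-singular. Let $S\subseteq\mathbb{R}^n$ be convex, and let $f:\mathbb{R}^m\times\mathbb{R}^n\to\mathbb{R}$ be convex with respect to its first variable $a$, concave with respect to its second variable $x$, and differentiable in $a$ over $\mathbb{R}^m_{++}$. Assume that $f(\cdot,x)$ is either increasing or decreasing. Define $$g_-(t)=t-\ln t-1\ \ (0<t\le 1),\qquad g_+(t)=t-\ln t-1\ \ (1\le t<\infty).$$ Then the worst-case scenario $a^*(\tau;x)$ at the point $x$ satisfies the following. 1. If $f(\cdot,x)$ is increasing, then for $x\in S$ that satisfies $\nabla_a f(a,x)\ne 0$ (for all $a\in\mathbb{R}^m_{++}$), $$g_-^{-1}(\tau\|A^{-1}\|)\,a^0_i\le a^*_i(\tau;x)\le a^0_i,\qquad i\in\mathcal{I}(x).$$ 2. If $f(\cdot,x)$ is decreasing, then for $x\in S$ that satisfies $\nabla_a f(a,x)\ne 0$ (for all $a\in\mathbb{R}^m_{++}$), $$a^0_i\le a^*_i(\tau;x)\le g_+^{-1}(\tau\|A^{-1}\|)\,a^0_i,\qquad i\in\mathcal{I}(x).$$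
   Context: $\mathbb{R}^m_{++}$ is the set of vectors with all entries positive. For a vector or a matrix, $\|\cdot\|$ denotes an arbitrary norm defined on the corresponding space. With $A^0=\operatorname{diag}(a^0)$, the uncertainty set is $$\Omega(\tau)=\Omega(a^0,\tau,A)=\{a\in\mathbb{R}^m:\exists z,y\in\mathbb{R}^m,\ z_i>0,\ a=A^0z,\ z_i-\ln z_i-1\le y_i\ (i=1,\dots,m),\ \|Ay\|\le\tau\}.$$ The worst-case scenario at $x$ is $a^*(\tau;x)=\operatorname{arg\,min}_{a\in\Omega(\tau)}f(a,x)$ (a point of $\Omega(\tau)$ attaining the minimum). The index set is $\mathcal{I}(x)=\{i:\frac{\partial}{\partial a_i}f(a,x)\ne 0\ \text{for all }a\in\mathbb{R}^m_{++}\}$. The function $f(\cdot,x)$ is called increasing (resp. decreasing) if $\frac{\partial}{\partial a_i}f(a,x)\ge 0$ (resp. $\le 0$) for all $i=1,\dots,m$ and all $a\in\mathbb{R}^m_{++}$. $g_-^{-1}:[0,\infty)\to(0,1]$ and $g_+^{-1}:[0,\infty)\to[1,\infty)$ are the inverse functions of the bijections $g_-$ and $g_+$.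
   Formalization: The vector and matrix norms are not unrelated arbitrary norms: they are assumed to satisfy max_i |(Mv)_i| ≤ ‖M‖‖v‖ for all M and v; without such a relation the bounds fail (m=1, A=1, a⁰=1, f=a, τ=1, matrix norm |·|/2). *)

theory Defs
  imports "HOL-Analysis.Analysis"
begin

definition is_norm :: "('v::real_vector \<Rightarrow> real) \<Rightarrow> bool" where
  "is_norm N \<longleftrightarrow>
     (\<forall>v. 0 \<le> N v) \<and>
     (\<forall>v. N v = 0 \<longleftrightarrow> v = 0) \<and>
     (\<forall>c v. N (c *\<^sub>R v) = \<bar>c\<bar> * N v) \<and>
     (\<forall>v w. N (v + w) \<le> N v + N w)"

(* The bounds compare norms of A y with norms of inverse matrices, so some relation between
   the scales of the two norms is needed: every coordinate of M v is at most
   Nm M * N v in absolute value (infnorm is the maximum norm). For every norm N there are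
   such matrix norms Nm, for instance the operator norm from N to the maximum norm. The
   usual consistent pairs are covered by compatible_normsI. *)
definition compatible_norms ::
  "(real^'m \<Rightarrow> real) \<Rightarrow> (real^'m^'m \<Rightarrow> real) \<Rightarrow> bool" where
  "compatible_norms N Nm \<longleftrightarrow> (\<forall>M v. infnorm (M *v v) \<le> Nm M * N v)"

lemma compatible_normsI:
  fixes N :: "real^'m \<Rightarrow> real" and Nm :: "real^'m^'m \<Rightarrow> real"
  assumes "\<And>M v. N (M *v v) \<le> Nm M * N v"
    and "\<And>v. infnorm v \<le> N v"
  shows "compatible_norms N Nm"
  unfolding compatible_norms_def using assms order_trans by blast

definition pos_orthant :: "(real^'m) set" where
  "pos_orthant = {a. \<forall>i. 0 < a $ i}"

definition diag :: "real^'m \<Rightarrow> real^'m^'m" where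
  "diag v = (\<chi> i j. if i = j then v $ i else 0)"

definition uncertainty_set ::
  "(real^'m \<Rightarrow> real) \<Rightarrow> real^'m \<Rightarrow> real \<Rightarrow> real^'m^'m \<Rightarrow> (real^'m) set" where
  "uncertainty_set N a0 \<tau> A =
     {a. \<exists>z y. (\<forall>i. 0 < z $ i) \<and> a = diag a0 *v z \<and>
        (\<forall>i. z $ i - ln (z $ i) - 1 \<le> y $ i) \<and> N (A *v y) \<le> \<tau>}"

(* The minimizer need not be unique, so this is a predicate: astar is some point of the
   uncertainty set at which f(.,x) attains its minimum over that set. *)
definition worst_case ::
  "(real^'m \<Rightarrow> real) \<Rightarrow> real^'m \<Rightarrow> real^'m^'m \<Rightarrow> (real^'m \<Rightarrow> real^'n \<Rightarrow> real) \<Rightarrow>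
   real \<Rightarrow> real^'n \<Rightarrow> real^'m \<Rightarrow> bool" where
  "worst_case N a0 A f \<tau> x astar \<longleftrightarrow>
     is_arg_min (\<lambda>a. f a x) (\<lambda>a. a \<in> uncertainty_set N a0 \<tau> A) astar"

definition partial_deriv :: "(real^'m \<Rightarrow> real) \<Rightarrow> 'm \<Rightarrow> real^'m \<Rightarrow> real" where
  "partial_deriv h i a = deriv (\<lambda>t. h (\<chi> j. if j = i then t else a $ j)) (a $ i)"

definition gradient :: "(real^'m \<Rightarrow> real) \<Rightarrow> real^'m \<Rightarrow> real^'m" where
  "gradient h a = (\<chi> i. partial_deriv h i a)"

definition increasing_fun :: "(real^'m \<Rightarrow> real) \<Rightarrow> bool" where
  "increasing_fun h \<longleftrightarrow> (\<forall>i. \<forall>a\<in>pos_orthant. 0 \<le> partial_deriv h i a)"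

definition decreasing_fun :: "(real^'m \<Rightarrow> real) \<Rightarrow> bool" where
  "decreasing_fun h \<longleftrightarrow> (\<forall>i. \<forall>a\<in>pos_orthant. partial_deriv h i a \<le> 0)"

definition index_set :: "(real^'m \<Rightarrow> real^'n \<Rightarrow> real) \<Rightarrow> real^'n \<Rightarrow> 'm set" where
  "index_set f x = {i. \<forall>a\<in>pos_orthant. partial_deriv (\<lambda>a. f a x) i a \<noteq> 0}"

(* t - ln t - 1 is a bijection from (0,1] onto [0,\<infinity>) and from [1,\<infinity>) onto [0,\<infinity>); the two
   functions below are the inverses of these restrictions, meaningful for arguments \<ge> 0. *)
definition g_minus_inv :: "real \<Rightarrow> real" where
  "g_minus_inv = the_inv_into {0<..1} (\<lambda>t. t - ln t - 1)"

definition g_plus_inv :: "real \<Rightarrow> real" where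
  "g_plus_inv = the_inv_into {1..} (\<lambda>t. t - ln t - 1)"

end

theory Submission
  imports Defs
begin

text \<open>
  Let \<open>g t = t - ln t - 1\<close> and write a point of the uncertainty set as \<open>a = A\<^sup>0 z\<close>, with a
  vector \<open>y\<close> that dominates \<open>g z\<close> componentwise and satisfies \<open>N (A y) \<le> \<tau>\<close>. Two
  independent observations give the two sides of the bounds.

  The outer bounds hold for every point of the uncertainty set: since \<open>y = A\<^sup>-\<^sup>1 (A y)\<close>,
  compatibility of the norms gives \<open>g (z\<^sub>i) \<le> y\<^sub>i \<le> \<tau> Nm (A\<^sup>-\<^sup>1)\<close>, and \<open>g\<close> is strictly
  monotone on either side of 1, so \<open>z\<^sub>i\<close> lies between the solutions of
  \<open>g t = \<tau> Nm (A\<^sup>-\<^sup>1)\<close> below and above 1 (\<open>uncertainty_setE\<close>, \<open>g_minus_inv_le\<close>, \<open>le_g_plus_inv\<close>).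

  The inner bounds come from minimality. As \<open>g\<close> has its minimum 0 at 1, setting \<open>z\<^sub>i\<close> to 1 and
  keeping \<open>y\<close> preserves all constraints, so the uncertainty set is closed under resetting the
  coordinate \<open>a\<^sub>i\<close> to its nominal value \<open>a\<^sup>0\<^sub>i\<close> (\<open>uncertainty_set_reset\<close>). If the \<open>i\<close>-th
  partial derivative of the objective is positive on the positive orthant, then resetting a
  coordinate that exceeds \<open>a\<^sup>0\<^sub>i\<close> strictly lowers the objective, which is impossible at a minimizer; if it is
  negative there, the same holds for a coordinate below \<open>a\<^sup>0\<^sub>i\<close>. For an increasing or
  decreasing objective, the indices whose partial derivative has such a strict sign are exactly
  those in the index set.
\<close>

section \<open>The function \<open>t - ln t - 1\<close> and its two inverse branches\<close>

lemma g_strict_antimono: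
  fixes s t :: real
  assumes "0 < s" "s < t" "t \<le> 1"
  shows "t - ln t - 1 < s - ln s - 1"
proof -
  have "ln s - ln t < (s - t) / t"
    using ln_diff_less[of s t] assms by simp
  also have "\<dots> \<le> s - t"
    using assms by (simp add: divide_simps mult_le_cancel_left1)
  finally show ?thesis by simp
qed

lemma g_strict_mono:
  fixes s t :: real
  assumes "1 \<le> s" "s < t"
  shows "s - ln s - 1 < t - ln t - 1"
proof -
  have "ln t - ln s < (t - s) / s"
    using ln_diff_less[of t s] assms by simp
  also have "\<dots> \<le> t - s"
    using assms by (simp add: divide_simps mult_le_cancel_left1)
  finally show ?thesis by simp
qed

lemma g_minus_inv:
  assumes "0 \<le> c"
  shows "0 < g_minus_inv c" "g_minus_inv c \<le> 1"
    and "g_minus_inv c - ln (g_minus_inv c) - 1 = c"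
proof -
  let ?g = "\<lambda>t::real. t - ln t - 1"
  have inj: "inj_on ?g {0<..1}"
    by (rule linorder_inj_onI) (use g_strict_antimono in fastforce)+
  (* At exp (- (c + 1)) the logarithm alone already contributes c + 1. *)
  have "\<exists>t. exp (- (c + 1)) \<le> t \<and> t \<le> 1 \<and> ?g t = c"
  proof (rule IVT2')
    have "0 < t" if "exp (- (c + 1)) \<le> t" for t :: real
      using that exp_gt_zero[of "- (c + 1)"] by linarith
    then show "continuous_on {exp (- (c + 1))..1} ?g"
      by (intro continuous_intros) auto
  qed (use assms in auto)
  then obtain t where t: "exp (- (c + 1)) \<le> t" "t \<le> 1" "?g t = c"
    by blast
  have "0 < t"
    using t(1) exp_gt_zero[of "- (c + 1)"] by linarith
  moreover from this have "g_minus_inv c = t"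
    unfolding g_minus_inv_def using inj t by (intro the_inv_into_f_eq) auto
  ultimately show "0 < g_minus_inv c" "g_minus_inv c \<le> 1"
    "g_minus_inv c - ln (g_minus_inv c) - 1 = c"
    using t by auto
qed

lemma g_plus_inv:
  assumes "0 \<le> c"
  shows "1 \<le> g_plus_inv c" "g_plus_inv c - ln (g_plus_inv c) - 1 = c"
proof -
  let ?g = "\<lambda>t::real. t - ln t - 1"
  have inj: "inj_on ?g {1..}"
    by (rule linorder_inj_onI) (use g_strict_mono in fastforce)+
  (* Since ln t \<le> t / 2 - 1 + ln 2 and ln 2 \<le> 1, the value of g at 2 * c + 2 is at least c. *)
  have "\<exists>t. 1 \<le> t \<and> t \<le> 2 * c + 2 \<and> ?g t = c"
  proof (rule IVT')
    have "ln (2 * c + 2) = ln 2 + ln (c + 1)"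
      using ln_mult_pos[of 2 "c + 1"] assms by (simp add: algebra_simps)
    then show "c \<le> ?g (2 * c + 2)"
      using ln_le_minus_one[of 2] ln_le_minus_one[of "c + 1"] assms by simp
    show "continuous_on {1..2 * c + 2} ?g"
      by (intro continuous_intros) auto
  qed (use assms in auto)
  then obtain t where t: "1 \<le> t" "?g t = c"
    by blast
  then have "g_plus_inv c = t"
    unfolding g_plus_inv_def using inj by (intro the_inv_into_f_eq) auto
  then show "1 \<le> g_plus_inv c" "g_plus_inv c - ln (g_plus_inv c) - 1 = c"
    using t by auto
qed

text \<open>
  A sublevel set of \<open>t - ln t - 1\<close> is the interval between the values of the two inverse
  branches; each of the next two lemmas gives one end of it.
\<close>

lemma g_minus_inv_le:
  assumes "0 \<le> c" "0 < z" "z - ln z - 1 \<le> c"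
  shows "g_minus_inv c \<le> z"
proof (rule ccontr)
  assume "\<not> g_minus_inv c \<le> z"
  then have "g_minus_inv c - ln (g_minus_inv c) - 1 < z - ln z - 1"
    using assms(2) g_minus_inv(2)[OF assms(1)] by (intro g_strict_antimono) auto
  then show False
    using assms(3) g_minus_inv(3)[OF assms(1)] by simp
qed

lemma le_g_plus_inv:
  assumes "0 \<le> c" "z - ln z - 1 \<le> c"
  shows "z \<le> g_plus_inv c"
proof (rule ccontr)
  assume "\<not> z \<le> g_plus_inv c"
  then have "g_plus_inv c - ln (g_plus_inv c) - 1 < z - ln z - 1"
    using g_plus_inv(1)[OF assms(1)] by (intro g_strict_mono) auto
  then show False
    using assms(2) g_plus_inv(2)[OF assms(1)] by simp
qed

section \<open>The uncertainty set\<close>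

lemma diag_mult_vec: "(diag v *v z) $ i = v $ i * z $ i"
proof -
  have "(diag v *v z) $ i = (\<Sum>j\<in>UNIV. if i = j then v $ i * z $ j else 0)"
    by (simp add: diag_def matrix_vector_mult_def if_distrib[of "\<lambda>u. u * _"] cong: if_cong)
  then show ?thesis by simp
qed

lemma matrix_inv_mult_vec:
  fixes A :: "real^'m^'m"
  assumes "invertible A"
  shows "matrix_inv A *v (A *v y) = y"
proof -
  have "\<exists>B. A ** B = mat 1 \<and> B ** A = mat 1"
    using assms by (simp add: invertible_def)
  then have "matrix_inv A ** A = mat 1"
    unfolding matrix_inv_def by (rule someI2_ex) simp
  then show ?thesis
    by (simp add: matrix_vector_mul_assoc)
qed

text \<open>
  The norm constraint on \<open>A y\<close> becomes a bound on each single coordinate of \<open>y\<close>, because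
  \<open>y = A\<^sup>-\<^sup>1 (A y)\<close> and compatible norms control the maximum norm of such a product.
\<close>

lemma uncertainty_setE:
  fixes A :: "real^'m^'m"
  assumes "a \<in> uncertainty_set N a0 \<tau> A"
    and "is_norm Nm" "compatible_norms N Nm" "invertible A"
  obtains z where "\<And>i. 0 < z $ i" "\<And>i. a $ i = a0 $ i * z $ i"
    "\<And>i. z $ i - ln (z $ i) - 1 \<le> \<tau> * Nm (matrix_inv A)"
proof -
  from assms(1) obtain z y where z: "\<forall>i. 0 < z $ i" and a: "a = diag a0 *v z"
    and y: "\<forall>i. z $ i - ln (z $ i) - 1 \<le> y $ i" and Ay: "N (A *v y) \<le> \<tau>"
    unfolding uncertainty_set_def by blast
  have "z $ i - ln (z $ i) - 1 \<le> \<tau> * Nm (matrix_inv A)" for i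
  proof -
    have "y $ i \<le> infnorm (matrix_inv A *v (A *v y))"
      using component_le_infnorm_cart[of y i] by (simp add: matrix_inv_mult_vec[OF assms(4)])
    also have "\<dots> \<le> Nm (matrix_inv A) * N (A *v y)"
      using assms(3) by (simp add: compatible_norms_def)
    also have "\<dots> \<le> Nm (matrix_inv A) * \<tau>"
      using assms(2) Ay by (intro mult_left_mono) (auto simp: is_norm_def)
    finally show ?thesis
      using y[rule_format, of i] by (simp add: mult.commute)
  qed
  moreover have "a $ i = a0 $ i * z $ i" for i
    by (simp add: a diag_mult_vec)
  ultimately show ?thesis
    using that z by blast
qed

lemma uncertainty_set_subset_pos_orthant:
  assumes "a0 \<in> pos_orthant"
  shows "uncertainty_set N a0 \<tau> A \<subseteq> pos_orthant"
  using assms by (auto simp: uncertainty_set_def pos_orthant_def diag_mult_vec)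

text \<open>
  Resetting \<open>a\<^sub>i\<close> to \<open>a\<^sup>0\<^sub>i\<close> means setting \<open>z\<^sub>i\<close> to 1, the minimizer of \<open>t - ln t - 1\<close>; the
  same \<open>y\<close> therefore remains a witness.
\<close>

lemma uncertainty_set_reset:
  assumes "a \<in> uncertainty_set N a0 \<tau> A"
  shows "(\<chi> j. if j = i then a0 $ i else a $ j) \<in> uncertainty_set N a0 \<tau> A"
proof -
  from assms obtain z y where z: "\<forall>i. 0 < z $ i" and a: "a = diag a0 *v z"
    and y: "\<forall>i. z $ i - ln (z $ i) - 1 \<le> y $ i" and Ay: "N (A *v y) \<le> \<tau>"
    unfolding uncertainty_set_def by blast
  define z' where "z' = (\<chi> j. if j = i then 1 else z $ j)"
  have "(\<chi> j. if j = i then a0 $ i else a $ j) = diag a0 *v z'"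
    by (simp add: vec_eq_iff diag_mult_vec a z'_def)
  moreover have "\<forall>j. 0 < z' $ j"
    using z by (simp add: z'_def)
  moreover have "z' $ j - ln (z' $ j) - 1 \<le> y $ j" for j
  proof (cases "j = i")
    case True
    have "0 \<le> z $ i - ln (z $ i) - 1"
      using ln_le_minus_one[OF z[rule_format, of i]] by simp
    also have "\<dots> \<le> y $ i"
      using y by blast
    finally show ?thesis
      using True by (simp add: z'_def)
  qed (use y in \<open>simp add: z'_def\<close>)
  ultimately show ?thesis
    unfolding uncertainty_set_def using Ay by blast
qed

section \<open>Monotonicity along a coordinate\<close>

lemma open_pos_orthant: "open (pos_orthant :: (real^'m) set)"
proof -
  have "pos_orthant = (\<Inter>i. {a :: real^'m. 0 < a $ i})"
    by (auto simp: pos_orthant_def)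
  moreover have "open (\<Inter>i. {a :: real^'m. 0 < a $ i})"
    by (intro open_INT finite ballI open_Collect_less continuous_intros)
  ultimately show ?thesis by simp
qed

text \<open>
  A partial derivative is given as the value of \<open>deriv\<close>, which is meaningful only where a
  derivative exists; total differentiability on the orthant supplies existence.
\<close>

lemma has_partial_deriv:
  fixes h :: "real^'m \<Rightarrow> real"
  assumes h: "h differentiable_on pos_orthant" and a: "a \<in> pos_orthant" and "0 < t"
  shows "((\<lambda>s. h (\<chi> j. if j = i then s else a $ j)) has_real_derivative
           partial_deriv h i (\<chi> j. if j = i then t else a $ j)) (at t)"
proof -
  let ?p = "\<lambda>s. \<chi> j. if j = i then s else a $ j"
  have p_affine: "?p = (\<lambda>s. a + (s - a $ i) *\<^sub>R axis i 1)"
    by (simp add: fun_eq_iff vec_eq_iff axis_def)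
  have "?p t \<in> pos_orthant"
    using a \<open>0 < t\<close> by (simp add: pos_orthant_def)
  then have "h differentiable (at (?p t))"
    using h open_pos_orthant by (metis at_within_open differentiable_on_def)
  moreover have "?p differentiable (at t)"
    unfolding p_affine by (intro derivative_intros)
  ultimately have "(h \<circ> ?p) differentiable (at t)"
    by (intro differentiable_chain_at)
  then have "((h \<circ> ?p) has_real_derivative deriv (h \<circ> ?p) t) (at t)"
    by (simp add: DERIV_deriv_iff_real_differentiable)
  then show ?thesis
    by (simp add: partial_deriv_def o_def cong: if_cong)
qed

lemma increasing_along_coordinate:
  fixes h :: "real^'m \<Rightarrow> real"
  assumes "h differentiable_on pos_orthant" "a \<in> pos_orthant" "0 < s" "s < t"
    and "\<And>b. b \<in> pos_orthant \<Longrightarrow> 0 < partial_deriv h i b"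
  shows "h (\<chi> j. if j = i then s else a $ j) < h (\<chi> j. if j = i then t else a $ j)"
proof (rule DERIV_pos_imp_increasing[OF \<open>s < t\<close>])
  fix r assume "s \<le> r" "r \<le> t"
  then have "0 < r" using \<open>0 < s\<close> by simp
  then have "(\<chi> j. if j = i then r else a $ j) \<in> pos_orthant"
    using assms(2) by (simp add: pos_orthant_def)
  then show "\<exists>d. ((\<lambda>r. h (\<chi> j. if j = i then r else a $ j)) has_real_derivative d) (at r) \<and> 0 < d"
    using has_partial_deriv[OF assms(1,2) \<open>0 < r\<close>] assms(5) by blast
qed

lemma decreasing_along_coordinate:
  fixes h :: "real^'m \<Rightarrow> real"
  assumes "h differentiable_on pos_orthant" "a \<in> pos_orthant" "0 < s" "s < t"
    and "\<And>b. b \<in> pos_orthant \<Longrightarrow> partial_deriv h i b < 0"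
  shows "h (\<chi> j. if j = i then t else a $ j) < h (\<chi> j. if j = i then s else a $ j)"
proof (rule DERIV_neg_imp_decreasing[OF \<open>s < t\<close>])
  fix r assume "s \<le> r" "r \<le> t"
  then have "0 < r" using \<open>0 < s\<close> by simp
  then have "(\<chi> j. if j = i then r else a $ j) \<in> pos_orthant"
    using assms(2) by (simp add: pos_orthant_def)
  then show "\<exists>d. ((\<lambda>r. h (\<chi> j. if j = i then r else a $ j)) has_real_derivative d) (at r) \<and> d < 0"
    using has_partial_deriv[OF assms(1,2) \<open>0 < r\<close>] assms(5) by blast
qed

section \<open>Bounds on the worst-case scenario\<close>

lemma uncertainty_set_bounds:
  fixes A :: "real^'m^'m"
  assumes "a \<in> uncertainty_set N a0 \<tau> A"
    and "is_norm Nm" "compatible_norms N Nm" "invertible A"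
    and "a0 \<in> pos_orthant" "0 \<le> \<tau>"
  shows "g_minus_inv (\<tau> * Nm (matrix_inv A)) * a0 $ i \<le> a $ i"
    and "a $ i \<le> g_plus_inv (\<tau> * Nm (matrix_inv A)) * a0 $ i"
proof -
  obtain z where z: "\<And>i. 0 < z $ i" "\<And>i. a $ i = a0 $ i * z $ i"
    "\<And>i. z $ i - ln (z $ i) - 1 \<le> \<tau> * Nm (matrix_inv A)"
    using uncertainty_setE[OF assms(1-4)] by blast
  have c: "0 \<le> \<tau> * Nm (matrix_inv A)"
    using assms(2,6) by (simp add: is_norm_def)
  have "0 \<le> a0 $ i"
    using assms(5) by (simp add: pos_orthant_def less_imp_le)
  then show "g_minus_inv (\<tau> * Nm (matrix_inv A)) * a0 $ i \<le> a $ i"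
    and "a $ i \<le> g_plus_inv (\<tau> * Nm (matrix_inv A)) * a0 $ i"
    using g_minus_inv_le[OF c z(1,3), of i] le_g_plus_inv[OF c z(3), of i]
    by (simp_all add: z(2) mult.commute mult_left_mono)
qed

lemma worst_case_in_uncertainty_set:
  assumes "worst_case N a0 A f \<tau> x a"
  shows "a \<in> uncertainty_set N a0 \<tau> A"
  using assms unfolding worst_case_def is_arg_min_def by blast

lemma worst_case_le_reset:
  assumes "worst_case N a0 A f \<tau> x a"
  shows "f a x \<le> f (\<chi> j. if j = i then a0 $ i else a $ j) x"
proof -
  have min: "\<forall>b. \<not> (b \<in> uncertainty_set N a0 \<tau> A \<and> f b x < f a x)"
    using assms unfolding worst_case_def is_arg_min_def by blast
  show ?thesis
    using min[rule_format, of "\<chi> j. if j = i then a0 $ i else a $ j"]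
      uncertainty_set_reset[OF worst_case_in_uncertainty_set[OF assms], of i] by simp
qed

text \<open>
  A minimizer cannot exceed the nominal value in a coordinate along which the objective strictly
  increases, since the reset point would be better; dually for a strict decrease.
\<close>

lemma worst_case_le_nominal:
  assumes wc: "worst_case N a0 A f \<tau> x a" and a0: "a0 \<in> pos_orthant"
    and diff: "(\<lambda>a. f a x) differentiable_on pos_orthant"
    and inc: "increasing_fun (\<lambda>a. f a x)" and i: "i \<in> index_set f x"
  shows "a $ i \<le> a0 $ i"
proof (rule ccontr)
  assume "\<not> a $ i \<le> a0 $ i"
  moreover have "a \<in> pos_orthant"
    using worst_case_in_uncertainty_set[OF wc] uncertainty_set_subset_pos_orthant[OF a0] by blast
  moreover have "0 < partial_deriv (\<lambda>a. f a x) i b" if "b \<in> pos_orthant" for b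
    using that inc i by (simp add: increasing_fun_def index_set_def less_le)
  ultimately have "f (\<chi> j. if j = i then a0 $ i else a $ j) x
      < f (\<chi> j. if j = i then a $ i else a $ j) x"
    using a0 by (intro increasing_along_coordinate[OF diff]) (auto simp: pos_orthant_def)
  moreover have "(\<chi> j. if j = i then a $ i else a $ j) = a"
    by (simp add: vec_eq_iff)
  ultimately show False
    using worst_case_le_reset[OF wc, of i] by simp
qed

lemma nominal_le_worst_case:
  assumes wc: "worst_case N a0 A f \<tau> x a" and a0: "a0 \<in> pos_orthant"
    and diff: "(\<lambda>a. f a x) differentiable_on pos_orthant"
    and dec: "decreasing_fun (\<lambda>a. f a x)" and i: "i \<in> index_set f x"
  shows "a0 $ i \<le> a $ i"
proof (rule ccontr)
  assume "\<not> a0 $ i \<le> a $ i"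
  moreover have "a \<in> pos_orthant"
    using worst_case_in_uncertainty_set[OF wc] uncertainty_set_subset_pos_orthant[OF a0] by blast
  moreover have "partial_deriv (\<lambda>a. f a x) i b < 0" if "b \<in> pos_orthant" for b
    using that dec i by (simp add: decreasing_fun_def index_set_def less_le)
  ultimately have "f (\<chi> j. if j = i then a0 $ i else a $ j) x
      < f (\<chi> j. if j = i then a $ i else a $ j) x"
    by (intro decreasing_along_coordinate[OF diff]) (auto simp: pos_orthant_def)
  moreover have "(\<chi> j. if j = i then a $ i else a $ j) = a"
    by (simp add: vec_eq_iff)
  ultimately show False
    using worst_case_le_reset[OF wc, of i] by simp
qed

theorem theorem4p3:
  fixes N :: "real^'m \<Rightarrow> real"
    and Nm :: "real^'m^'m \<Rightarrow> real"
    and a0 :: "real^'m"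
    and \<tau> :: real
    and A :: "real^'m^'m"
    and S :: "(real^'n) set"
    and f :: "real^'m \<Rightarrow> real^'n \<Rightarrow> real"
  assumes "is_norm N" and "is_norm Nm" and "compatible_norms N Nm"
    and "a0 \<in> pos_orthant" and "0 \<le> \<tau>" and "invertible A"
    and "convex S"
    and "\<forall>x. convex_on UNIV (\<lambda>a. f a x)"
    and "\<forall>a. concave_on UNIV (\<lambda>x. f a x)"
    and "\<forall>x. (\<lambda>a. f a x) differentiable_on pos_orthant"
    and "\<forall>x\<in>S. increasing_fun (\<lambda>a. f a x) \<or> decreasing_fun (\<lambda>a. f a x)"
  shows "\<forall>x\<in>S. (\<forall>a\<in>pos_orthant. gradient (\<lambda>a. f a x) a \<noteq> 0) \<longrightarrow>
           (\<forall>astar. worst_case N a0 A f \<tau> x astar \<longrightarrow>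
             (increasing_fun (\<lambda>a. f a x) \<longrightarrow>
               (\<forall>i\<in>index_set f x.
                  g_minus_inv (\<tau> * Nm (matrix_inv A)) * a0 $ i \<le> astar $ i \<and>
                  astar $ i \<le> a0 $ i)) \<and>
             (decreasing_fun (\<lambda>a. f a x) \<longrightarrow>
               (\<forall>i\<in>index_set f x.
                  a0 $ i \<le> astar $ i \<and>
                  astar $ i \<le> g_plus_inv (\<tau> * Nm (matrix_inv A)) * a0 $ i)))"
proof (intro ballI impI allI)
  fix x astar
  assume wc: "worst_case N a0 A f \<tau> x astar"
  have diff: "(\<lambda>a. f a x) differentiable_on pos_orthant"
    using assms(10) by blast
  note bounds =
    uncertainty_set_bounds[OF worst_case_in_uncertainty_set[OF wc] assms(2,3,6,4,5)]
  show "(increasing_fun (\<lambda>a. f a x) \<longrightarrow>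
          (\<forall>i\<in>index_set f x.
             g_minus_inv (\<tau> * Nm (matrix_inv A)) * a0 $ i \<le> astar $ i \<and> astar $ i \<le> a0 $ i)) \<and>
        (decreasing_fun (\<lambda>a. f a x) \<longrightarrow>
          (\<forall>i\<in>index_set f x.
             a0 $ i \<le> astar $ i \<and> astar $ i \<le> g_plus_inv (\<tau> * Nm (matrix_inv A)) * a0 $ i))"
    using bounds worst_case_le_nominal[OF wc assms(4) diff]
      nominal_le_worst_case[OF wc assms(4) diff] by blast
qed

end
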